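(* For all non-negative integers $r_0, r_1$, not both zero, and each real $R> 0$, the following holds. Suppose that $\mathcal{H}$ is a non-empty $(r_0, r_1)$-bounded hypergraph on $V=V_0\cup V_1$ (with $V_0,V_1$ disjoint finite sets), and $b,m,q$ are positive integers with $b\leq \min\{m,|V_1|\}$, satisfying \[\Delta_{(\ell_0,\ell_1)}(\mathcal{H})\leq R \frac{b^{\ell_0+\ell_1-1}}{m^{\ell_0}|V_1|^{\ell_1}}e(\mathcal{H})\left(\frac{m}{q}\right)^{{1}[\ell_0>0]}\] for every pair $(\ell_0,\ell_1)\in \{0,1,\ldots,r_0\}\times\{0,1,\ldots,r_1\}\setminus \{(0,0)\}$. Then there exist a family $\mathcal{S}\subset \binom{V_0}{\leq r_0b}\times\binom{V_1}{\leq r_1b}$ and functions $f\colon \mathcal{S}\to 2^{V_0}\times 2^{V_1}$ and $g\colon \mathcal{F}_{\leq m}(\mathcal{H})\to \mathcal{S}$ such that, letting $\delta=2^{-(r_0+r_1+1)(r_0+r_1)}R^{-1}$: (i) if $(I,J)\in\mathcal{F}_{\leq m}(\mathcal{H})$ and $f(g(I,J))=(A,B)$, then $A\subset I$ and $J\subset B$; (ii) for every $(A,B)\in f(\mathcal{S})$, either $|A|\geq \delta q$ or $|B|\leq (1-\delta)|V_1|$; (iii) if $g(I,J)=(S_0,S_1)$ and $f(g(I,J))=(A,B)$, then $S_0\subset V_0\setminus I$ and $S_1\subset J$, and $|S_0|>0$ only if $|A|\geq \delta q$.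
   Context: Given disjoint finite sets $V_0,V_1$, an $(r_0,r_1)$-bounded hypergraph $\mathcal{H}$ on $V=V_0\cup V_1$ is a set of edges $E(\mathcal{H})\subset \binom{V_0}{\leq r_0}\times \binom{V_1}{\leq r_1}$; $e(\mathcal{H})=|E(\mathcal{H})|$. A pair $(W_0,W_1)\in 2^{V_0}\times 2^{V_1}$ violates an edge $(e_0,e_1)$ if $e_0\subset V_0\setminus W_0$ and $e_1\subset W_1$; it is independent if it violates no edge. $\mathcal{F}_{\leq m}(\mathcal{H})$ is the family of independent pairs $(W_0,W_1)$ with $|W_0|\leq m$. For $L_0\subset V_0$, $L_1\subset V_1$, the codegree $d_{(L_0,L_1)}(\mathcal{H})$ is the number of edges $(e_0,e_1)$ with $L_0\subset e_0$ and $L_1\subset e_1$, and $\Delta_{(\ell_0,\ell_1)}(\mathcal{H})=\max\{d_{(L_0,L_1)}(\mathcal{H}): |L_0|=\ell_0,|L_1|=\ell_1\}$. $1[\ell_0>0]$ is $1$ if $\ell_0>0$ and $0$ otherwise. $\binom{X}{\le k}$ denotes the family of subsets of $X$ of size at most $k$. *)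

theory Defs
  imports Complex_Main
begin

definition bounded_hypergraph ::
  "'a set \<Rightarrow> 'a set \<Rightarrow> nat \<Rightarrow> nat \<Rightarrow> ('a set \<times> 'a set) set \<Rightarrow> bool" where
  "bounded_hypergraph V0 V1 r0 r1 H \<longleftrightarrow>
     (\<forall>(e0, e1) \<in> H. e0 \<subseteq> V0 \<and> card e0 \<le> r0 \<and> e1 \<subseteq> V1 \<and> card e1 \<le> r1)"

definition violates :: "'a set \<times> 'a set \<Rightarrow> 'a set \<Rightarrow> 'a set \<times> 'a set \<Rightarrow> bool" where
  "violates W V0 e \<longleftrightarrow> fst e \<subseteq> V0 - fst W \<and> snd e \<subseteq> snd W"

definition independent ::
  "'a set \<Rightarrow> ('a set \<times> 'a set) set \<Rightarrow> 'a set \<times> 'a set \<Rightarrow> bool" where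
  "independent V0 H W \<longleftrightarrow> (\<forall>e\<in>H. \<not> violates W V0 e)"

definition indep_family ::
  "'a set \<Rightarrow> 'a set \<Rightarrow> ('a set \<times> 'a set) set \<Rightarrow> nat \<Rightarrow> ('a set \<times> 'a set) set" where
  "indep_family V0 V1 H m =
     {(W0, W1). W0 \<subseteq> V0 \<and> W1 \<subseteq> V1 \<and> independent V0 H (W0, W1) \<and> card W0 \<le> m}"

definition codegree :: "('a set \<times> 'a set) set \<Rightarrow> 'a set \<Rightarrow> 'a set \<Rightarrow> nat" where
  "codegree H L0 L1 = card {(e0, e1) \<in> H. L0 \<subseteq> e0 \<and> L1 \<subseteq> e1}"

text \<open>Maximum codegree over L0 \<subseteq> V0, L1 \<subseteq> V1 of sizes l0, l1 (0 if no such sets).\<close>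
definition max_codegree ::
  "'a set \<Rightarrow> 'a set \<Rightarrow> ('a set \<times> 'a set) set \<Rightarrow> nat \<Rightarrow> nat \<Rightarrow> nat" where
  "max_codegree V0 V1 H l0 l1 =
     Max (insert 0 {codegree H L0 L1 | L0 L1.
            L0 \<subseteq> V0 \<and> card L0 = l0 \<and> L1 \<subseteq> V1 \<and> card L1 = l1})"

end

theory Submission
  imports Defs
begin

text \<open>
  Encode a pair \<open>(I, J)\<close> by the single set \<open>X = (V0 - I) \<union> J\<close>; then \<open>(I, J)\<close> violates an edge
  \<open>(e0, e1)\<close> exactly when \<open>e0 \<union> e1 \<subseteq> X\<close>. The containers come from a decision tree whose queries
  have the form ``is \<open>v\<close> in \<open>X\<close>?''. The positive answers form the fingerprint \<open>(S0, S1)\<close>, the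
  negative ones give \<open>A\<close> and \<open>V1 - B\<close>, and the positive answers alone determine the path.

  One level of the tree queries vertices of high degree on one side. A positive answer moves the
  edges through the vertex to the link hypergraph, a negative one deletes them; edges containing a
  set whose degree in the link is about to exceed its bound are deleted as well, and there are few
  of those. Either a constant proportion of the edges is lost to negative answers, which
  makes their number large, or at most \<open>b\<close> positive answers produce a link hypergraph with one
  vertex less per edge that satisfies the same degree condition with a larger \<open>R\<close>. The side \<open>V1\<close>
  is exhausted first, since high degree vertices in \<open>V0\<close> are available only for edges inside \<open>V0\<close>:
  these all meet \<open>V0 - X\<close>, which has at most \<open>m\<close> elements.
\<close>

section \<open>Query trees\<close>

datatype 'a query_tree = Leaf | Query 'a "'a query_tree" "'a query_tree"

primrec hits :: "'a query_tree \<Rightarrow> 'a set \<Rightarrow> 'a set" where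
  "hits Leaf X = {}"
| "hits (Query v t u) X = (if v \<in> X then insert v (hits t X) else hits u X)"

primrec misses :: "'a query_tree \<Rightarrow> 'a set \<Rightarrow> 'a set" where
  "misses Leaf X = {}"
| "misses (Query v t u) X = (if v \<in> X then misses t X else insert v (misses u X))"

lemma finite_misses [simp]: "finite (misses t X)"
  by (induction t) auto

lemma hits_subset: "hits t X \<subseteq> X"
  by (induction t) auto

lemma misses_disjoint: "misses t X \<inter> X = {}"
  by (induction t) auto

text \<open>Both runs follow the same path: a vertex of \<open>X\<close> queried on it is a hit,
  hence in \<open>Z\<close>, and a vertex outside \<open>X\<close> is outside \<open>Z\<close>. This
  makes the container a function of the fingerprint.\<close>

lemma misses_determined:
  "hits t X \<subseteq> Z \<Longrightarrow> Z \<subseteq> X \<Longrightarrow> misses t Z = misses t X"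
  by (induction t) (auto split: if_splits)

section \<open>One level of the tree\<close>

text \<open>Edges are indexed, so that distinct edges may have the same vertex set: links of different
  vertices may create such parallel edges.\<close>

definition deg :: "'i set \<Rightarrow> ('i \<Rightarrow> 'a set) \<Rightarrow> 'a set \<Rightarrow> nat" where
  "deg E tr L = card {x \<in> E. L \<subseteq> tr x}"

lemma deg_mono: "finite E \<Longrightarrow> D \<subseteq> E \<Longrightarrow> deg D tr L \<le> deg E tr L"
  unfolding deg_def by (rule card_mono) auto

lemma deg_eq_0: "(\<And>x. x \<in> E \<Longrightarrow> \<not> L \<subseteq> tr x) \<Longrightarrow> deg E tr L = 0"
  unfolding deg_def by (metis (mono_tags, lifting) card.empty empty_Collect_eq)

lemma sum_deg:
  assumes "finite E" "finite A"
  shows "(\<Sum>L\<in>A. deg E tr L) = (\<Sum>x\<in>E. card {L \<in> A. L \<subseteq> tr x})"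
proof -
  have "(\<Sum>L\<in>A. deg E tr L) = (\<Sum>L\<in>A. \<Sum>x\<in>E. if L \<subseteq> tr x then 1 else 0)"
    using assms by (simp add: deg_def sum.If_cases Int_def)
  also have "\<dots> = (\<Sum>x\<in>E. \<Sum>L\<in>A. if L \<subseteq> tr x then 1 else 0)"
    by (rule sum.swap)
  also have "\<dots> = (\<Sum>x\<in>E. card {L \<in> A. L \<subseteq> tr x})"
    using assms by (simp add: sum.If_cases Int_def)
  finally show ?thesis .
qed

lemma card_covered_le_sum_deg:
  assumes "finite E" "finite A" "\<And>x. x \<in> D \<Longrightarrow> x \<in> E \<and> (\<exists>L\<in>A. L \<subseteq> tr x)"
  shows "card D \<le> (\<Sum>L\<in>A. deg E tr L)"
proof -
  have "D \<subseteq> (\<Union>L\<in>A. {x \<in> E. L \<subseteq> tr x})"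
    using assms(3) by blast
  then have "card D \<le> card (\<Union>L\<in>A. {x \<in> E. L \<subseteq> tr x})"
    using assms by (intro card_mono) auto
  also have "\<dots> \<le> (\<Sum>L\<in>A. deg E tr L)"
    unfolding deg_def using assms(2) by (rule card_UN_le)
  finally show ?thesis .
qed

text \<open>\<open>U\<close> holds the vertices that may be queried, \<open>M\<close> bounds the
  size of a subset of \<open>U\<close> meeting all edges, and \<open>\<tau> L\<close> caps the
  degree of \<open>L\<close> in the link. By \<open>deg_insert\<close>, one positive answer raises
  this degree by at most half of the cap; \<open>deg_le\<close> and \<open>\<kappa>_le\<close> limit
  the edges lost to sets that have reached half of it.\<close>

locale level =
  fixes E :: "'i set" and tr :: "'i \<Rightarrow> 'a set" and U :: "'a set"
    and M K \<kappa> :: real and b k :: nat and \<tau> :: "'a set \<Rightarrow> real"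
  assumes finite_E: "finite E" and E_nonempty: "E \<noteq> {}"
    and finite_tr: "\<And>x. x \<in> E \<Longrightarrow> finite (tr x)"
    and card_tr: "\<And>x. x \<in> E \<Longrightarrow> card (tr x) \<le> k"
    and finite_U: "finite U"
    and b_pos: "b > 0" and b_le_M: "real b \<le> M" and K_pos: "K > 0"
    and \<kappa>_nonneg: "\<kappa> \<ge> 0" and \<kappa>_le: "12 * \<kappa> * (2 ^ (k - 1) - 1) \<le> 1"
    and deg_vertex: "\<And>v. v \<in> U \<Longrightarrow> real (deg E tr {v}) \<le> K * card E"
    and deg_insert: "\<And>L v. L \<noteq> {} \<Longrightarrow> v \<in> U \<Longrightarrow> v \<notin> L \<Longrightarrow>
          real (deg E tr (insert v L)) \<le> \<tau> L / 2"
    and deg_le: "\<And>L. L \<noteq> {} \<Longrightarrow>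
          real (deg E tr L) * (b * card E / (4 * M)) \<le> \<kappa> * card E * \<tau> L"
begin

text \<open>The size at which a link is handed to the next level: each of \<open>b\<close> positive
  answers is to contribute at least \<open>card E / (4 * M)\<close> edges.\<close>

definition goal :: real where "goal = b * card E / (4 * M)"

text \<open>The threshold is half of the cap, so that one more query, adding at most the other half,
  cannot exceed it.\<close>

definition saturated :: "'i set \<Rightarrow> ('i \<Rightarrow> 'a set) \<Rightarrow> 'i \<Rightarrow> bool" where
  "saturated P g x \<longleftrightarrow> (\<exists>L. L \<noteq> {} \<and> L \<subseteq> tr x \<and> \<tau> L / 2 \<le> deg P g L)"

definition link :: "'i set \<Rightarrow> ('i \<Rightarrow> 'a set) \<Rightarrow> bool" where
  "link P g \<longleftrightarrow> P \<subseteq> E \<and> (\<forall>x\<in>P. \<exists>v\<in>U \<inter> tr x. g x = tr x - {v}) \<and>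
     (\<forall>L. L \<noteq> {} \<longrightarrow> deg P g L \<le> \<tau> L)"

definition admissible :: "'a set \<Rightarrow> bool" where
  "admissible X \<longleftrightarrow> (\<forall>x\<in>E. \<not> tr x \<subseteq> X) \<and>
     (\<exists>T\<subseteq>U. card T \<le> M \<and> (\<forall>x\<in>E. tr x \<inter> T \<noteq> {}))"

text \<open>\<open>\<Gamma>\<close> are the edges still in play, \<open>(P, g)\<close> is the link built so far, \<open>s\<close> counts the
  positive answers and \<open>N\<close> is the set of negative ones.\<close>

definition state :: "'i set \<Rightarrow> 'i set \<Rightarrow> ('i \<Rightarrow> 'a set) \<Rightarrow> 'a set \<Rightarrow> nat \<Rightarrow> bool" where
  "state \<Gamma> P g N s \<longleftrightarrow> \<Gamma> \<subseteq> E \<and> \<Gamma> \<inter> P = {} \<and> link P g \<and> N \<subseteq> U \<and> s \<le> b \<and>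
     s * card E / (4 * M) \<le> card P \<and> (\<forall>x\<in>\<Gamma>. \<not> saturated P g x) \<and>
     (\<forall>x\<in>E. x \<in> \<Gamma> \<or> x \<in> P \<or> tr x \<inter> N \<noteq> {} \<or> saturated P g x)"

text \<open>\<open>N\<close> and \<open>s\<close> record the answers given before the subtree
  \<open>t\<close> is entered. Either the level ends with many negative answers in \<open>U\<close>,
  or it reaches a link of full size and continues with the tree \<open>F P g\<close>; then
  \<open>Y\<close> and \<open>N'\<close> stand for the answers within \<open>t\<close> before that
  continuation.\<close>

definition outcome :: "('i set \<Rightarrow> ('i \<Rightarrow> 'a set) \<Rightarrow> 'a query_tree) \<Rightarrow>
    'a set \<Rightarrow> nat \<Rightarrow> 'a query_tree \<Rightarrow> 'a set \<Rightarrow> bool" where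
  "outcome F N s t X \<longleftrightarrow>
     hits t X \<subseteq> U \<and> s + card (hits t X) \<le> b \<and> 1 / (3 * K) \<le> card (N \<union> misses t X \<inter> U) \<or>
     (\<exists>P g Y N'. link P g \<and> goal \<le> card P \<and> (\<forall>x\<in>P. \<not> g x \<subseteq> X) \<and> Y \<subseteq> U \<and> s + card Y \<le> b \<and>
        hits t X = Y \<union> hits (F P g) X \<and> misses t X = N' \<union> misses (F P g) X)"

section \<open>Edge counts and invariants within one level\<close>

lemma card_E_pos: "card E > 0"
  using finite_E E_nonempty by (simp add: card_gt_0_iff)

lemma M_pos: "M > 0"
  using b_pos b_le_M by linarith

lemma goal_pos: "goal > 0"
  unfolding goal_def using b_pos card_E_pos M_pos by simp

lemma goal_le: "goal \<le> card E / 4"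
  unfolding goal_def using b_le_M M_pos card_E_pos
  by (simp add: field_simps)

text \<open>An edge of the link has at most \<open>k - 1\<close> vertices, hence at most
  \<open>2 ^ (k - 1) - 1\<close> nonempty subsets; pairs of an edge and a subset of it are counted
  in two ways.\<close>

lemma link_sum_deg:
  assumes "link P g" "finite A" "{} \<notin> A"
  shows "(\<Sum>L\<in>A. real (deg P g L)) \<le> (2 ^ (k - 1) - 1) * real (card P)"
proof -
  have P: "P \<subseteq> E" "finite P"
    using assms(1) finite_E finite_subset by (auto simp: link_def)
  have "card {L \<in> A. L \<subseteq> g x} \<le> 2 ^ (k - 1) - 1" if x: "x \<in> P" for x
  proof -
    obtain v where v: "v \<in> tr x" "g x = tr x - {v}"
      using assms(1) x by (auto simp: link_def)
    have fin: "finite (tr x)" and "card (tr x) \<le> k"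
      using P x finite_tr card_tr by auto
    then have "card (g x) \<le> k - 1" and fg: "finite (g x)"
      using v by auto
    then have "(2::nat) ^ card (g x) \<le> 2 ^ (k - 1)"
      by simp
    moreover have "card {L \<in> A. L \<subseteq> g x} \<le> card (Pow (g x) - {{}})"
      using fg assms(3) by (intro card_mono) auto
    moreover have "card (Pow (g x) - {{}}) = 2 ^ card (g x) - 1"
      using fg by (simp add: card_Diff_singleton card_Pow)
    ultimately show ?thesis by linarith
  qed
  then have "(\<Sum>x\<in>P. card {L \<in> A. L \<subseteq> g x}) \<le> card P * (2 ^ (k - 1) - 1)"
    using sum_bounded_above[of P "\<lambda>x. card {L \<in> A. L \<subseteq> g x}" "2 ^ (k - 1) - 1"] by simp
  then have "(\<Sum>L\<in>A. deg P g L) \<le> card P * (2 ^ (k - 1) - 1)"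
    using sum_deg[OF P(2) assms(2), of g] by simp
  then have "real (\<Sum>L\<in>A. deg P g L) \<le> real (card P * (2 ^ (k - 1) - 1))"
    by (rule of_nat_mono)
  then show ?thesis
    by (simp add: of_nat_diff mult.commute)
qed

text \<open>Every saturated edge contains a set from the family \<open>A\<close> of sets at half of
  their cap or more. By \<open>deg_le\<close>, the degree of such a set in \<open>E\<close> is at
  most \<open>2 * \<kappa> * card E / goal\<close> times its degree in the link, and
  \<open>link_sum_deg\<close> bounds the sum of the latter.\<close>

lemma card_saturated:
  assumes "link P g" "card P \<le> goal"
  shows "card {x \<in> E. saturated P g x} \<le> card E / 6"
proof -
  define A where "A = {L. L \<noteq> {} \<and> L \<subseteq> \<Union>(tr ` E) \<and> \<tau> L / 2 \<le> deg P g L}"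
  have "A \<subseteq> Pow (\<Union>(tr ` E))"
    unfolding A_def by blast
  moreover have "finite (\<Union>(tr ` E))"
    using finite_E finite_tr by blast
  ultimately have finA: "finite A"
    by (meson finite_Pow_iff finite_subset)
  have "card {x \<in> E. saturated P g x} \<le> (\<Sum>L\<in>A. deg E tr L)"
  proof (rule card_covered_le_sum_deg[OF finite_E finA])
    fix x assume x: "x \<in> {x \<in> E. saturated P g x}"
    then obtain L where "L \<noteq> {}" "L \<subseteq> tr x" "\<tau> L / 2 \<le> deg P g L"
      unfolding saturated_def by blast
    with x show "x \<in> E \<and> (\<exists>L\<in>A. L \<subseteq> tr x)"
      unfolding A_def by blast
  qed
  then have "real (card {x \<in> E. saturated P g x}) \<le> real (\<Sum>L\<in>A. deg E tr L)"
    by (rule of_nat_mono)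
  then have "card {x \<in> E. saturated P g x} * goal \<le> (\<Sum>L\<in>A. real (deg E tr L)) * goal"
    using goal_pos by (intro mult_right_mono) simp_all
  also have "\<dots> = (\<Sum>L\<in>A. real (deg E tr L) * goal)"
    by (rule sum_distrib_right)
  also have "\<dots> \<le> (\<Sum>L\<in>A. \<kappa> * card E * (2 * deg P g L))"
  proof (rule sum_mono)
    fix L assume L: "L \<in> A"
    have "real (deg E tr L) * goal \<le> \<kappa> * card E * \<tau> L"
      using deg_le[of L] L by (simp add: goal_def A_def)
    also have "\<dots> \<le> \<kappa> * card E * (2 * deg P g L)"
      using L \<kappa>_nonneg by (intro mult_left_mono) (auto simp: A_def)
    finally show "real (deg E tr L) * goal \<le> \<kappa> * card E * (2 * deg P g L)" .
  qed
  also have "\<dots> = 2 * \<kappa> * card E * (\<Sum>L\<in>A. real (deg P g L))"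
    by (simp add: sum_distrib_left mult_ac)
  also have "\<dots> \<le> 2 * \<kappa> * card E * ((2 ^ (k - 1) - 1) * real (card P))"
    using \<kappa>_nonneg finA by (intro mult_left_mono link_sum_deg[OF assms(1)]) (auto simp: A_def)
  also have "\<dots> = (12 * \<kappa> * (2 ^ (k - 1) - 1)) * (real (card E) * real (card P) / 6)"
    by simp
  also have "\<dots> \<le> 1 * (real (card E) * real (card P) / 6)"
    using \<kappa>_le by (intro mult_right_mono) auto
  also have "\<dots> \<le> card E / 6 * goal"
    using mult_left_mono[OF assms(2), of "card E / 6"] by simp
  finally show ?thesis
    using goal_pos by simp
qed

text \<open>The edges in play and the link each take less than a quarter of \<open>E\<close>,
  saturated edges at most a sixth, so at least a third of \<open>E\<close> meets \<open>N\<close>;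
  each vertex of \<open>N\<close> accounts for at most \<open>K * card E\<close> of these.\<close>

lemma many_misses:
  assumes "state \<Gamma> P g N s" "card P < goal" "card \<Gamma> < card E / 4"
  shows "1 / (3 * K) \<le> card N"
proof -
  have st: "\<Gamma> \<subseteq> E" "link P g" "N \<subseteq> U" "P \<subseteq> E"
    "\<And>x. x \<in> E \<Longrightarrow> x \<in> \<Gamma> \<or> x \<in> P \<or> tr x \<inter> N \<noteq> {} \<or> saturated P g x"
    using assms(1) by (auto simp: state_def link_def)
  have finN: "finite N"
    using st(3) finite_U finite_subset by blast
  let ?hit = "{x \<in> E. tr x \<inter> N \<noteq> {}}" and ?sat = "{x \<in> E. saturated P g x}"
  have "card ?hit \<le> (\<Sum>L\<in>(\<lambda>v. {v}) ` N. deg E tr L)"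
    by (rule card_covered_le_sum_deg[OF finite_E]) (use finN in auto)
  also have "\<dots> = (\<Sum>v\<in>N. deg E tr {v})"
    by (subst sum.reindex) (auto simp: inj_on_def)
  finally have "card ?hit \<le> (\<Sum>v\<in>N. real (deg E tr {v}))"
    by (simp flip: of_nat_sum)
  also have "\<dots> \<le> (\<Sum>v\<in>N. K * card E)"
    using deg_vertex st(3) by (intro sum_mono) blast
  finally have hit: "card ?hit \<le> card N * (K * card E)"
    by simp
  have "E \<subseteq> (\<Gamma> \<union> P) \<union> (?hit \<union> ?sat)"
    using st(5) by blast
  then have "card E \<le> card ((\<Gamma> \<union> P) \<union> (?hit \<union> ?sat))"
    using st finite_E by (intro card_mono) (auto intro: finite_subset)
  also have "\<dots> \<le> card \<Gamma> + card P + (card ?hit + card ?sat)"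
    by (intro order.trans[OF card_Un_le] add_mono card_Un_le)
  finally have "real (card E) \<le> card \<Gamma> + card P + (card ?hit + card ?sat)"
    by linarith
  then have "card E / 3 \<le> card N * (K * card E)"
    using hit card_saturated[OF st(2)] assms(2,3) goal_le by linarith
  then have "1 / 3 \<le> card N * K"
    using card_E_pos by (simp add: field_simps)
  then show ?thesis
    using K_pos by (simp add: field_simps)
qed

text \<open>Averaging over the set \<open>T\<close>, which meets every edge and has at most
  \<open>M\<close> elements.\<close>

lemma high_degree_vertex:
  assumes "admissible X" "\<Gamma> \<subseteq> E" "\<Gamma> \<noteq> {}"
  shows "\<exists>v\<in>U. card \<Gamma> / M \<le> deg \<Gamma> tr {v}"
proof (rule ccontr)
  assume "\<not> ?thesis"
  then have small: "real (deg \<Gamma> tr {v}) < card \<Gamma> / M" if "v \<in> U" for v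
    using that by (meson not_le)
  obtain T where T: "T \<subseteq> U" "card T \<le> M" "\<forall>x\<in>E. tr x \<inter> T \<noteq> {}"
    using assms(1) by (auto simp: admissible_def)
  have fin: "finite T" "finite \<Gamma>"
    using T assms finite_U finite_E finite_subset by blast+
  have "T \<noteq> {}"
    using T assms by auto
  have "card \<Gamma> \<le> (\<Sum>L\<in>(\<lambda>v. {v}) ` T. deg \<Gamma> tr L)"
  proof (rule card_covered_le_sum_deg)
    fix x assume x: "x \<in> \<Gamma>"
    then obtain v where "v \<in> T" "v \<in> tr x"
      using T(3) assms(2) by auto
    with x show "x \<in> \<Gamma> \<and> (\<exists>L\<in>(\<lambda>v. {v}) ` T. L \<subseteq> tr x)"
      by auto
  qed (use fin in auto)
  also have "\<dots> = (\<Sum>v\<in>T. deg \<Gamma> tr {v})"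
    by (subst sum.reindex) (auto simp: inj_on_def)
  finally have "card \<Gamma> \<le> (\<Sum>v\<in>T. real (deg \<Gamma> tr {v}))"
    by (simp flip: of_nat_sum)
  also have "\<dots> < (\<Sum>v\<in>T. card \<Gamma> / M)"
    using \<open>T \<noteq> {}\<close> fin T small by (intro sum_strict_mono) auto
  also have "\<dots> = card T * (card \<Gamma> / M)"
    by simp
  also have "\<dots> \<le> M * (card \<Gamma> / M)"
    using T M_pos by (intro mult_right_mono) auto
  finally show False
    using M_pos by simp
qed

text \<open>New link edges containing \<open>L\<close> come from edges containing
  \<open>insert v L\<close>, so \<open>deg_insert\<close> adds at most half of the cap, and only to
  sets still below half: they lie in an edge of \<open>\<Gamma>\<close>, none of which is saturated.
  As \<open>\<Gamma>\<close> is at least a quarter of \<open>E\<close>, the degree of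
  \<open>v\<close> yields at least \<open>card E / (4 * M)\<close> new edges.\<close>

lemma state_hit:
  assumes st: "state \<Gamma> P g N s" and v: "v \<in> U" "card \<Gamma> / M \<le> deg \<Gamma> tr {v}"
    and large: "card E / 4 \<le> card \<Gamma>" and P_small: "card P < goal"
  defines "P' \<equiv> P \<union> {x \<in> \<Gamma>. v \<in> tr x}"
    and "g' \<equiv> \<lambda>x. if x \<in> \<Gamma> \<and> v \<in> tr x then tr x - {v} else g x"
  shows "state {x \<in> \<Gamma>. v \<notin> tr x \<and> \<not> saturated P' g' x} P' g' N (Suc s)"
proof -
  have \<Gamma>: "\<Gamma> \<subseteq> E" "\<Gamma> \<inter> P = {}" "finite \<Gamma>" and lk: "link P g" "P \<subseteq> E" "finite P"
    using st finite_E by (auto simp: state_def link_def intro: finite_subset)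
  have deg': "deg P' g' L = deg P g L + card {x \<in> \<Gamma>. v \<in> tr x \<and> L \<subseteq> tr x - {v}}" for L
  proof -
    have "{x \<in> P'. L \<subseteq> g' x} = {x \<in> P. L \<subseteq> g x} \<union> {x \<in> \<Gamma>. v \<in> tr x \<and> L \<subseteq> tr x - {v}}"
      using \<Gamma>(2) by (auto simp: P'_def g'_def)
    then show ?thesis
      unfolding deg_def using \<Gamma> lk by (simp, intro card_Un_disjoint) auto
  qed
  have "real (deg P' g' L) \<le> \<tau> L" if L: "L \<noteq> {}" for L
  proof (cases "\<exists>x\<in>\<Gamma>. v \<in> tr x \<and> L \<subseteq> tr x - {v}")
    case False
    then have "{x \<in> \<Gamma>. v \<in> tr x \<and> L \<subseteq> tr x - {v}} = {}"
      by blast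
    then have "deg P' g' L = deg P g L"
      by (simp only: deg' card.empty)
    then show ?thesis
      using lk L by (simp add: link_def)
  next
    case True
    then obtain x where x: "x \<in> \<Gamma>" "L \<subseteq> tr x" "v \<notin> L"
      by blast
    have "card {x \<in> \<Gamma>. v \<in> tr x \<and> L \<subseteq> tr x - {v}} \<le> deg E tr (insert v L)"
      unfolding deg_def using \<Gamma> finite_E by (intro card_mono) auto
    moreover have "\<not> saturated P g x"
      using st x(1) by (simp add: state_def)
    then have "deg P g L < \<tau> L / 2"
      using x(2) L unfolding saturated_def by (meson not_le)
    ultimately show ?thesis
      using deg' [of L] deg_insert[OF L v(1) x(3)] by linarith
  qed
  moreover have "\<exists>u\<in>U \<inter> tr x. g' x = tr x - {u}" if "x \<in> P'" for x
    using that lk v(1) \<Gamma>(2) by (auto simp: P'_def g'_def link_def)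
  ultimately have "link P' g'"
    using \<Gamma> lk by (auto simp: link_def P'_def)
  moreover have "Suc s * card E / (4 * M) \<le> card P'"
  proof -
    have "card P' = card P + deg \<Gamma> tr {v}"
      unfolding P'_def deg_def using \<Gamma> lk by (subst card_Un_disjoint) auto
    moreover have "card E / (4 * M) \<le> card \<Gamma> / M"
      using divide_right_mono[OF large, of M] M_pos by simp
    moreover have "s * card E / (4 * M) \<le> card P"
      using st by (simp add: state_def)
    ultimately show ?thesis
      using v(2) by (simp add: add_divide_distrib distrib_right)
  qed
  \<comment> \<open>A link smaller than \<open>goal\<close> cannot have used up all \<open>b\<close>
    positive answers.\<close>
  moreover have "Suc s \<le> b"
  proof -
    have "s * card E / (4 * M) < b * card E / (4 * M)"
      using st P_small by (simp add: state_def goal_def)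
    then have "s < b"
      using M_pos card_E_pos by (simp add: divide_less_cancel)
    then show ?thesis by simp
  qed
  \<comment> \<open>Degrees in the link only grow, so edges dropped as saturated stay accounted
    for.\<close>
  moreover have sat_mono: "saturated P' g' x" if x: "saturated P g x" for x
  proof -
    obtain L where L: "L \<noteq> {}" "L \<subseteq> tr x" "\<tau> L / 2 \<le> deg P g L"
      using x unfolding saturated_def by blast
    then have "\<tau> L / 2 \<le> deg P' g' L"
      by (simp only: deg' of_nat_add)
    with L(1,2) show ?thesis
      unfolding saturated_def by blast
  qed
  moreover have "x \<in> {x \<in> \<Gamma>. v \<notin> tr x \<and> \<not> saturated P' g' x} \<or> x \<in> P' \<or>
      tr x \<inter> N \<noteq> {} \<or> saturated P' g' x" if "x \<in> E" for x
  proof -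
    have "x \<in> \<Gamma> \<or> x \<in> P \<or> tr x \<inter> N \<noteq> {} \<or> saturated P g x"
      using st that by (simp add: state_def)
    then show ?thesis
      using sat_mono[of x] by (auto simp: P'_def)
  qed
  moreover have "{x \<in> \<Gamma>. v \<notin> tr x \<and> \<not> saturated P' g' x} \<inter> P' = {}"
    using \<Gamma>(2) by (auto simp: P'_def)
  moreover have "N \<subseteq> U"
    using st by (simp add: state_def)
  ultimately show ?thesis
    unfolding state_def using \<Gamma>(1) by (intro conjI) auto
qed

lemma state_miss:
  assumes "state \<Gamma> P g N s" "v \<in> U"
  shows "state {x \<in> \<Gamma>. v \<notin> tr x} P g (insert v N) s"
proof -
  have "x \<in> {x \<in> \<Gamma>. v \<notin> tr x} \<or> x \<in> P \<or> tr x \<inter> insert v N \<noteq> {} \<or> saturated P g x"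
    if "x \<in> E" for x
    using assms(1) that by (auto simp: state_def)
  then show ?thesis
    using assms unfolding state_def by (intro conjI) auto
qed

section \<open>Growing the tree of one level\<close>

lemma outcome_hit:
  assumes "outcome F N (Suc s) t X" "v \<in> X" "v \<in> U"
  shows "outcome F N s (Query v t u) X"
proof -
  have *: "s + card (insert v Y) \<le> b" if "Suc s + card Y \<le> b" for Y :: "'a set"
    using that card_insert_le_m1[of "Suc (card Y)" Y v] by simp
  show ?thesis
    using assms(1) unfolding outcome_def
  proof (elim disjE exE conjE, goal_cases)
    case 1
    then show ?case
      using assms * by simp
  next
    case (2 P g Y N')
    then have "link P g \<and> goal \<le> card P \<and> (\<forall>x\<in>P. \<not> g x \<subseteq> X) \<and> insert v Y \<subseteq> U \<and>
        s + card (insert v Y) \<le> b \<and> hits (Query v t u) X = insert v Y \<union> hits (F P g) X \<and>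
        misses (Query v t u) X = N' \<union> misses (F P g) X"
      using assms * by simp
    then show ?case by blast
  qed
qed

lemma outcome_miss:
  assumes "outcome F (insert v N) s u X" "v \<notin> X" "v \<in> U"
  shows "outcome F N s (Query v t u) X"
proof -
  have *: "N \<union> insert v (misses u X) \<inter> U = insert v N \<union> misses u X \<inter> U"
    using assms(3) by blast
  show ?thesis
    using assms(1) unfolding outcome_def
  proof (elim disjE exE conjE, goal_cases)
    case 1
    then show ?case
      using assms * by simp
  next
    case (2 P g Y N')
    then have "link P g \<and> goal \<le> card P \<and> (\<forall>x\<in>P. \<not> g x \<subseteq> X) \<and> Y \<subseteq> U \<and>
        s + card Y \<le> b \<and> hits (Query v t u) X = Y \<union> hits (F P g) X \<and>
        misses (Query v t u) X = insert v N' \<union> misses (F P g) X"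
      using assms by simp
    then show ?case by blast
  qed
qed

text \<open>Induction on the number of edges in play. The queried vertex depends only on the state,
  not on \<open>X\<close>, and it lies in some edge of \<open>\<Gamma>\<close>, so either answer
  shrinks \<open>\<Gamma>\<close>.\<close>

lemma state_tree:
  assumes "state \<Gamma> P g N s"
  shows "\<exists>t. \<forall>X. admissible X \<longrightarrow> (\<forall>x\<in>P. \<not> g x \<subseteq> X) \<longrightarrow> outcome F N s t X"
  using assms
proof (induction "card \<Gamma>" arbitrary: \<Gamma> P g N s rule: less_induct)
  case less
  note st = less.prems
  have \<Gamma>: "\<Gamma> \<subseteq> E" "finite \<Gamma>" and lk: "link P g" and s: "s \<le> b"
    using st finite_E by (auto simp: state_def intro: finite_subset)
  consider (link) "goal \<le> card P"
    | (few) "card P < goal" "card \<Gamma> < card E / 4"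
    | (stuck) "card E / 4 \<le> card \<Gamma>" "\<not> (\<exists>v\<in>U. card \<Gamma> / M \<le> deg \<Gamma> tr {v})"
    | (query) v where "card P < goal" "card E / 4 \<le> card \<Gamma>"
        "v \<in> U" "card \<Gamma> / M \<le> deg \<Gamma> tr {v}"
    by (meson not_le)
  then show ?case
  proof cases
    case link
    have "outcome F N s (F P g) X" if "\<forall>x\<in>P. \<not> g x \<subseteq> X" for X
      unfolding outcome_def
      by (rule disjI2, rule exI[of _ P], rule exI[of _ g], rule exI[of _ "{}"], rule exI[of _ "{}"])
        (use that lk s link in simp)
    then show ?thesis by blast
  next
    case few
    then have "outcome F N s Leaf X" for X
      using many_misses[OF st] s by (simp add: outcome_def)
    then show ?thesis by blast
  next
    case stuck
    \<comment> \<open>Without a vertex of high degree no \<open>X\<close> is admissible, so every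
      tree qualifies.\<close>
    have "\<Gamma> \<noteq> {}"
      using stuck(1) card_E_pos by auto
    then show ?thesis
      using stuck(2) high_degree_vertex \<Gamma> by blast
  next
    case query
    define P' where "P' = P \<union> {x \<in> \<Gamma>. v \<in> tr x}"
    define g' where "g' = (\<lambda>x. if x \<in> \<Gamma> \<and> v \<in> tr x then tr x - {v} else g x)"
    define \<Gamma>1 where "\<Gamma>1 = {x \<in> \<Gamma>. v \<notin> tr x \<and> \<not> saturated P' g' x}"
    define \<Gamma>2 where "\<Gamma>2 = {x \<in> \<Gamma>. v \<notin> tr x}"
    have "card \<Gamma> > 0"
      using query(2) card_E_pos by linarith
    then have "card \<Gamma> / M > 0"
      using M_pos by simp
    then have "deg \<Gamma> tr {v} \<noteq> 0"
      using query(4) by linarith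
    then obtain x where x: "x \<in> \<Gamma>" "v \<in> tr x"
      using deg_eq_0[of \<Gamma> "{v}" tr] by auto
    have less1: "card \<Gamma>1 < card \<Gamma>" and less2: "card \<Gamma>2 < card \<Gamma>"
      using x \<Gamma> by (auto simp: \<Gamma>1_def \<Gamma>2_def intro!: psubset_card_mono)
    have "state \<Gamma>1 P' g' N (Suc s)"
      unfolding \<Gamma>1_def P'_def g'_def by (rule state_hit[OF st query(3,4,2,1)])
    then obtain t where t: "\<And>X. admissible X \<Longrightarrow> \<forall>x\<in>P'. \<not> g' x \<subseteq> X \<Longrightarrow> outcome F N (Suc s) t X"
      using less.hyps[OF less1] by blast
    have "state \<Gamma>2 P g (insert v N) s"
      unfolding \<Gamma>2_def by (rule state_miss[OF st query(3)])
    then obtain u where u: "\<And>X. admissible X \<Longrightarrow> \<forall>x\<in>P. \<not> g x \<subseteq> X \<Longrightarrow> outcome F (insert v N) s u X"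
      using less.hyps[OF less2] by blast
    have "outcome F N s (Query v t u) X" if X: "admissible X" "\<forall>x\<in>P. \<not> g x \<subseteq> X" for X
    proof (cases "v \<in> X")
      case True
      \<comment> \<open>Removing a vertex of \<open>X\<close> from an edge not inside
        \<open>X\<close> leaves a set not inside \<open>X\<close>.\<close>
      have "\<not> g' x \<subseteq> X" if "x \<in> P'" for x
      proof (cases "x \<in> \<Gamma> \<and> v \<in> tr x")
        case in_\<Gamma>: True
        then have "\<not> tr x \<subseteq> X"
          using X(1) \<Gamma> by (auto simp: admissible_def)
        then show ?thesis
          using in_\<Gamma> True by (auto simp: g'_def)
      qed (use that X(2) in \<open>auto simp: P'_def g'_def\<close>)
      then show ?thesis
        using outcome_hit t X(1) True query(3) by blast
    next
      case False
      then show ?thesis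
        using outcome_miss u X query(3) by blast
    qed
    then show ?thesis by blast
  qed
qed

text \<open>The run starts with all edges in play and an empty link; positivity of
  \<open>\<tau>\<close> ensures that no edge is saturated yet.\<close>

lemma level_tree:
  assumes "\<And>L. L \<noteq> {} \<Longrightarrow> \<tau> L > 0"
  shows "\<exists>t. \<forall>X. admissible X \<longrightarrow> outcome F {} 0 t X"
proof -
  have "deg {} tr L = 0" for L
    by (simp add: deg_def)
  then have "state E {} tr {} 0"
    using assms by (simp add: state_def link_def saturated_def not_le less_imp_le) blast
  then show ?thesis
    using state_tree by blast
qed

end

section \<open>Descending through the levels\<close>

locale two_sides =
  fixes V0 V1 :: "'a set" and b m q :: nat
  assumes finite_V0: "finite V0" and finite_V1: "finite V1" and V_disjoint: "V0 \<inter> V1 = {}"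
    and b_pos: "b > 0" and m_pos: "m > 0" and q_pos: "q > 0"
    and b_le_m: "b \<le> m" and b_le_V1: "b \<le> card V1"
begin

text \<open>The right side of the degree condition without \<open>R\<close> and the number of edges,
  where l0 and l1 are the numbers of elements of \<open>L\<close> in \<open>V0\<close> and
  \<open>V1\<close>. The truncated \<open>- 1\<close> is harmless for nonempty
  \<open>L \<subseteq> V0 \<union> V1\<close>.\<close>

definition weight :: "'a set \<Rightarrow> real" where
  "weight L = real b ^ (card (L \<inter> V0) + card (L \<inter> V1) - 1) /
     (real m ^ card (L \<inter> V0) * real (card V1) ^ card (L \<inter> V1)) *
     (if card (L \<inter> V0) > 0 then real m / real q else 1)"

definition bounded_edges :: "nat \<Rightarrow> nat \<Rightarrow> 'i set \<Rightarrow> ('i \<Rightarrow> 'a set) \<Rightarrow> bool" where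
  "bounded_edges i0 i1 E tr \<longleftrightarrow>
     (\<forall>x\<in>E. tr x \<subseteq> V0 \<union> V1 \<and> card (tr x \<inter> V0) \<le> i0 \<and> card (tr x \<inter> V1) \<le> i1)"

definition spread :: "real \<Rightarrow> 'i set \<Rightarrow> ('i \<Rightarrow> 'a set) \<Rightarrow> bool" where
  "spread R E tr \<longleftrightarrow> (\<forall>L. L \<noteq> {} \<longrightarrow> deg E tr L \<le> R * weight L * card E)"

text \<open>A run that ends with many negative answers in \<open>V1\<close> has had no positive one
  in \<open>V0\<close>; this yields the clause on nonempty \<open>S0\<close>. The condition
  \<open>i1 > 0\<close> excludes that alternative once only \<open>V0\<close> is left, where
  \<open>Y\<close> may meet \<open>V0\<close>.\<close>

definition good :: "nat \<Rightarrow> nat \<Rightarrow> real \<Rightarrow> 'a set \<Rightarrow> 'a set \<Rightarrow> bool" where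
  "good i0 i1 \<delta> Y N \<longleftrightarrow> card (Y \<inter> V0) \<le> i0 * b \<and> card (Y \<inter> V1) \<le> i1 * b \<and>
     (\<delta> * q \<le> card (N \<inter> V0) \<or> i1 > 0 \<and> Y \<inter> V0 = {} \<and> \<delta> * card V1 \<le> card (N \<inter> V1))"

definition allowed :: "'i set \<Rightarrow> ('i \<Rightarrow> 'a set) \<Rightarrow> 'a set \<Rightarrow> bool" where
  "allowed E tr X \<longleftrightarrow> card (V0 - X) \<le> m \<and> (\<forall>x\<in>E. \<not> tr x \<subseteq> X)"

definition solves :: "nat \<Rightarrow> nat \<Rightarrow> real \<Rightarrow> 'i set \<Rightarrow> ('i \<Rightarrow> 'a set) \<Rightarrow> 'a query_tree \<Rightarrow> bool" where
  "solves i0 i1 \<delta> E tr t \<longleftrightarrow>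
     (\<forall>X. allowed E tr X \<longrightarrow> good i0 i1 \<delta> (hits t X) (misses t X))"

section \<open>Weights of vertex sets\<close>

lemma card_V1_pos: "card V1 > 0"
  using b_pos b_le_V1 by linarith

lemma weight_pos: "weight L > 0"
  unfolding weight_def using b_pos m_pos q_pos card_V1_pos by simp

text \<open>As \<open>L\<close> is nonempty, the truncated exponent of \<open>b\<close> really grows
  by one, and \<open>m / q\<close> is untouched because \<open>L \<inter> V0\<close> is.\<close>

lemma weight_insert_V1:
  assumes "v \<in> V1" "v \<notin> L" "L \<noteq> {}" "L \<subseteq> V0 \<union> V1"
  shows "weight (insert v L) = weight L * (b / card V1)"
proof -
  have "insert v L \<inter> V0 = L \<inter> V0" "insert v L \<inter> V1 = insert v (L \<inter> V1)"
    using assms V_disjoint by auto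
  moreover have "card (L \<inter> V0) + card (L \<inter> V1) \<noteq> 0"
    using assms finite_V0 finite_V1 by auto
  then obtain j where "card (L \<inter> V0) + card (L \<inter> V1) = Suc j"
    by (rule not0_implies_Suc[THEN exE])
  ultimately show ?thesis
    using assms(2) finite_V1 unfolding weight_def by (simp add: mult_ac)
qed

text \<open>A nonempty \<open>L \<subseteq> V0\<close> already carries the factor
  \<open>m / q\<close>. For nonempty \<open>L \<subseteq> V1\<close> it would appear anew, a further
  reason to exhaust \<open>V1\<close> first.\<close>

lemma weight_insert_V0:
  assumes "v \<in> V0" "v \<notin> L" "L \<noteq> {}" "L \<subseteq> V0"
  shows "weight (insert v L) = weight L * (b / m)"
proof -
  have "insert v L \<inter> V0 = insert v L" "L \<inter> V0 = L" "insert v L \<inter> V1 = {}" "L \<inter> V1 = {}"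
    using assms V_disjoint by auto
  moreover have "finite L"
    using assms(4) finite_V0 finite_subset by blast
  moreover from this obtain j where "card L = Suc j"
    using assms(3) by (metis card_0_eq not0_implies_Suc)
  ultimately show ?thesis
    using assms(2) unfolding weight_def by (simp add: mult_ac)
qed

lemma weight_singleton_V1: "v \<in> V1 \<Longrightarrow> weight {v} = 1 / card V1"
proof -
  assume "v \<in> V1"
  then have "{v} \<inter> V0 = {}" "{v} \<inter> V1 = {v}"
    using V_disjoint by auto
  then show ?thesis
    by (simp add: weight_def)
qed

lemma weight_singleton_V0: "v \<in> V0 \<Longrightarrow> weight {v} = 1 / q"
proof -
  assume "v \<in> V0"
  then have "{v} \<inter> V0 = {v}" "{v} \<inter> V1 = {}"
    using V_disjoint by auto
  then show ?thesis
    using m_pos by (simp add: weight_def)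
qed

section \<open>Spread families of edges\<close>

lemma bounded_edges_card:
  assumes "bounded_edges i0 i1 E tr" "x \<in> E"
  shows "finite (tr x)" "card (tr x) \<le> i0 + i1"
proof -
  have "tr x = (tr x \<inter> V0) \<union> (tr x \<inter> V1)"
    using assms by (auto simp: bounded_edges_def)
  then have "card (tr x) \<le> card (tr x \<inter> V0) + card (tr x \<inter> V1)"
    by (metis card_Un_le)
  then show "card (tr x) \<le> i0 + i1"
    using assms by (force simp: bounded_edges_def)
  show "finite (tr x)"
    using assms finite_V0 finite_V1 by (auto simp: bounded_edges_def intro: finite_subset)
qed

text \<open>Passing to a subfamily does not raise degrees; only the number of edges on the right
  side shrinks, by a factor of at most \<open>c\<close>.\<close>

lemma spread_subset:
  fixes c :: real
  assumes "spread R E tr" "finite E" "D \<subseteq> E" "real (card E) \<le> c * card D" "R > 0"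
  shows "spread (c * R) D tr"
  unfolding spread_def
proof (intro allI impI)
  fix L :: "'a set" assume L: "L \<noteq> {}"
  have "real (deg D tr L) \<le> deg E tr L"
    using deg_mono assms(2,3) by simp
  also have "\<dots> \<le> R * weight L * card E"
    using assms(1) L by (simp add: spread_def)
  also have "\<dots> \<le> R * weight L * (c * card D)"
    using assms(4,5) weight_pos[of L] by (intro mult_left_mono) simp_all
  finally show "deg D tr L \<le> c * R * weight L * card D"
    by (simp add: mult_ac)
qed

lemma spread_mono: "spread R E tr \<Longrightarrow> R \<le> R' \<Longrightarrow> spread R' E tr"
  unfolding spread_def
  by (meson less_imp_le mult_right_mono of_nat_0_le_iff order_trans weight_pos)

lemma allowed_subset: "allowed E tr X \<Longrightarrow> D \<subseteq> E \<Longrightarrow> allowed D tr X"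
  unfolding allowed_def by blast

text \<open>The cap is \<open>4 ^ Suc k * R * weight L\<close> times the target size of the link, so
  a finished link satisfies the degree condition with \<open>4 ^ Suc k * R\<close>. The factor
  \<open>4 / 3\<close> pays for keeping only about three quarters of the edges.\<close>

lemma level_interpretation:
  fixes tr :: "'i \<Rightarrow> 'a set" and M Q :: real
  assumes E: "finite E" "E \<noteq> {}" "bounded_edges i0 i1 E tr" "i0 + i1 = Suc k"
    and R: "R > 0" "spread (4 / 3 * R) E tr"
    and U: "finite U" "b \<le> M" "Q > 0"
    and single: "\<And>v. v \<in> U \<Longrightarrow> weight {v} = 1 / Q"
    and ins: "\<And>L v x. \<lbrakk>L \<noteq> {}; v \<in> U; v \<notin> L; x \<in> E; insert v L \<subseteq> tr x\<rbrakk> \<Longrightarrow>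
        weight (insert v L) = weight L * (b / M)"
  shows "level E tr U M (4 / 3 * R / Q) (4 / (3 * 4 ^ Suc k)) b (Suc k)
           (\<lambda>L. 4 ^ Suc k * R * weight L * (b * card E / (4 * M)))"
proof
  have M: "M > 0"
    using U(2) b_pos by linarith
  have cE: "card E > 0"
    using E by (simp add: card_gt_0_iff)
  have deg: "real (deg E tr L) \<le> 4 / 3 * R * weight L * card E" if "L \<noteq> {}" for L
    using R(2) that by (simp add: spread_def)
  \<comment> \<open>With \<open>y = 2 ^ k\<close> this is \<open>4 * (y - 1) \<le> y ^ 2\<close>,
    that is, \<open>(y - 2) ^ 2 \<ge> 0\<close>.\<close>
  show "12 * (4 / (3 * 4 ^ Suc k)) * (2 ^ (Suc k - 1) - 1) \<le> (1::real)"
  proof -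
    define y :: real where "y = 2 ^ k"
    have "(4::real) ^ k = y ^ 2"
      by (simp add: y_def power2_eq_square flip: power_mult_distrib)
    moreover have "y > 0"
      by (simp add: y_def)
    moreover have "0 \<le> (y - 2)\<^sup>2"
      by simp
    ultimately show ?thesis
      by (simp add: y_def[symmetric] field_simps power2_eq_square)
  qed
  show "real (deg E tr {v}) \<le> 4 / 3 * R / Q * card E" if "v \<in> U" for v
    using deg[of "{v}"] single[OF that] by simp
  show "real (deg E tr (insert v L)) \<le>
      4 ^ Suc k * R * weight L * (b * card E / (4 * M)) / 2"
    if L: "L \<noteq> {}" "v \<in> U" "v \<notin> L" for L v
  proof (cases "\<exists>x\<in>E. insert v L \<subseteq> tr x")
    case False
    then have "deg E tr (insert v L) = 0"
      by (intro deg_eq_0) blast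
    then show ?thesis
      using R(1) M weight_pos[of L] by simp
  next
    case True
    then obtain x where x: "x \<in> E" "insert v L \<subseteq> tr x"
      by blast
    have fin: "finite (tr x)" and le: "card (tr x) \<le> Suc k"
      using bounded_edges_card[OF E(3) x(1)] E(4) by auto
    have finL: "finite L"
      using finite_subset[OF x(2) fin] by simp
    \<comment> \<open>For \<open>k = 0\<close> the power of 4 would be too small, but an edge with
      two vertices forces \<open>k \<ge> 1\<close>.\<close>
    have "2 \<le> card (insert v L)"
      using L finL by (simp add: Suc_le_eq card_gt_0_iff)
    also have "\<dots> \<le> card (tr x)"
      using x(2) fin by (rule card_mono[rotated])
    finally have "1 \<le> k"
      using le by linarith
    then have "(4::real) ^ 1 \<le> 4 ^ k"
      by (intro power_increasing) auto
    then have pow: "(4::real) / 3 \<le> 4 ^ Suc k / 8"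
      by simp
    have "real (deg E tr (insert v L)) \<le> 4 / 3 * (R * weight L * (b / M) * card E)"
      using deg[of "insert v L"] ins[OF L x] by (simp add: mult_ac)
    also have "\<dots> \<le> 4 ^ Suc k / 8 * (R * weight L * (b / M) * card E)"
      using pow R(1) M weight_pos[of L] by (intro mult_right_mono) simp_all
    finally show ?thesis
      by (simp add: field_simps)
  qed
  show "real (deg E tr L) * (b * card E / (4 * M)) \<le>
      4 / (3 * 4 ^ Suc k) * card E * (4 ^ Suc k * R * weight L * (b * card E / (4 * M)))"
    if "L \<noteq> {}" for L
  proof -
    have "real (deg E tr L) * (b * card E / (4 * M)) \<le>
        4 / 3 * R * weight L * card E * (b * card E / (4 * M))"
      using deg[OF that] M by (intro mult_right_mono) simp_all
    then show ?thesis
      by (simp add: mult_ac)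
  qed
  show "finite (tr x)" "card (tr x) \<le> Suc k" if "x \<in> E" for x
    using bounded_edges_card[OF E(3) that] E(4) by simp_all
  show "finite E" "E \<noteq> {}" "finite U" "real b \<le> M" "0 < b"
    using E U b_pos by simp_all
  show "0 < 4 / 3 * R / Q" "0 \<le> 4 / (3 * 4 ^ Suc k :: real)"
    using R(1) U(3) by simp_all
qed

text \<open>Both sides share this argument; \<open>transversal\<close>, \<open>rec\<close>,
  \<open>combine\<close> and \<open>finish\<close> collect what depends on the side. The bound
  \<open>Q / (4 * R)\<close> in \<open>finish\<close> is \<open>1 / (3 * K)\<close> for
  \<open>K = 4 / 3 * R / Q\<close>.\<close>

lemma level_outcome:
  fixes tr :: "'i \<Rightarrow> 'a set" and M Q :: real
  assumes E: "finite E" "E \<noteq> {}" "bounded_edges i0 i1 E tr" "i0 + i1 = Suc k"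
    and R: "R > 0" "spread (4 / 3 * R) E tr"
    and U: "finite U" "b \<le> M" "Q > 0"
    and single: "\<And>v. v \<in> U \<Longrightarrow> weight {v} = 1 / Q"
    and ins: "\<And>L v x. \<lbrakk>L \<noteq> {}; v \<in> U; v \<notin> L; x \<in> E; insert v L \<subseteq> tr x\<rbrakk> \<Longrightarrow>
        weight (insert v L) = weight L * (b / M)"
    and transversal: "\<And>X. allowed E tr X \<Longrightarrow> \<exists>T\<subseteq>U. card T \<le> M \<and> (\<forall>x\<in>E. tr x \<inter> T \<noteq> {})"
    and rec: "\<And>P g. \<lbrakk>finite P; P \<noteq> {}; P \<subseteq> E; \<forall>x\<in>P. \<exists>v\<in>U \<inter> tr x. g x = tr x - {v};
        spread (4 ^ Suc k * R) P g\<rbrakk> \<Longrightarrow> \<exists>t. solves j0 j1 \<delta> P g t"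
    and combine: "\<And>Y' N' Y N. \<lbrakk>good j0 j1 \<delta> Y N; Y' \<subseteq> U; card Y' \<le> b; finite (N' \<union> N)\<rbrakk> \<Longrightarrow>
        good i0 i1 \<delta> (Y' \<union> Y) (N' \<union> N)"
    and finish: "\<And>Y N. \<lbrakk>Y \<subseteq> U; card Y \<le> b; Q / (4 * R) \<le> card (N \<inter> U)\<rbrakk> \<Longrightarrow>
        good i0 i1 \<delta> Y N"
  shows "\<exists>t. solves i0 i1 \<delta> E tr t"
proof -
  define \<tau> where "\<tau> = (\<lambda>L. 4 ^ Suc k * R * weight L * (b * card E / (4 * M)))"
  interpret level E tr U M "4 / 3 * R / Q" "4 / (3 * 4 ^ Suc k)" b "Suc k" \<tau>
    unfolding \<tau>_def by (rule level_interpretation[OF E R U single ins])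
  have \<tau>_goal: "\<tau> L = 4 ^ Suc k * R * weight L * goal" for L
    by (simp add: \<tau>_def goal_def)
  have link_solvable: "\<exists>t. solves j0 j1 \<delta> P g t" if lk: "link P g" "goal \<le> card P" for P g
  proof (rule rec)
    show "P \<subseteq> E" "\<forall>x\<in>P. \<exists>v\<in>U \<inter> tr x. g x = tr x - {v}"
      using lk(1) by (auto simp: link_def)
    then show "finite P"
      using finite_E finite_subset by blast
    show "P \<noteq> {}"
      using lk(2) goal_pos by auto
    show "spread (4 ^ Suc k * R) P g"
      unfolding spread_def
    proof (intro allI impI)
      fix L :: "'a set" assume "L \<noteq> {}"
      then have "real (deg P g L) \<le> \<tau> L"
        using lk(1) by (simp add: link_def)
      also have "\<dots> \<le> 4 ^ Suc k * R * weight L * card P"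
        unfolding \<tau>_goal using lk(2) R(1) weight_pos[of L] by (intro mult_left_mono) simp_all
      finally show "deg P g L \<le> 4 ^ Suc k * R * weight L * card P" .
    qed
  qed
  \<comment> \<open>The tree of this level refers to trees for all links that it may reach, so one
    solution per link is fixed in advance.\<close>
  define F :: "'i set \<Rightarrow> ('i \<Rightarrow> 'a set) \<Rightarrow> 'a query_tree"
    where "F = (\<lambda>P g. SOME t. solves j0 j1 \<delta> P g t)"
  have F: "solves j0 j1 \<delta> P g (F P g)" if "link P g" "goal \<le> card P" for P g
    unfolding F_def by (rule someI_ex) (rule link_solvable[OF that])
  have "\<tau> L > 0" for L
    unfolding \<tau>_goal using R(1) weight_pos goal_pos by simp
  then obtain t where t: "\<And>X. admissible X \<Longrightarrow> outcome F {} 0 t X"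
    using level_tree[of F] by blast
  have "good i0 i1 \<delta> (hits t X) (misses t X)" if X: "allowed E tr X" for X
  proof -
    have "admissible X"
      using X transversal[OF X] by (simp add: admissible_def allowed_def)
    from t[OF this] show ?thesis
      unfolding outcome_def
    proof (elim disjE exE conjE, goal_cases)
      case 1
      then show ?case
        using R(1) U(3) by (intro finish) (simp_all add: Int_commute)
    next
      case (2 P g Y N')
      have "allowed P g X"
        using X 2 by (simp add: allowed_def)
      then have "good j0 j1 \<delta> (hits (F P g) X) (misses (F P g) X)"
        using F[of P g] 2 by (simp add: solves_def)
      then show ?case
        using 2 combine[of "hits (F P g) X" "misses (F P g) X" Y N'] finite_misses[of t X]
        by simp
    qed
  qed
  then show ?thesis
    by (auto simp: solves_def)
qed

section \<open>Combining the levels by induction\<close>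

lemma good_combine_V1:
  assumes "good i0 j \<delta> Y N" "Y' \<subseteq> V1" "card Y' \<le> b" "finite (N' \<union> N)"
  shows "good i0 (Suc j) \<delta> (Y' \<union> Y) (N' \<union> N)"
proof -
  have "(Y' \<union> Y) \<inter> V0 = Y \<inter> V0"
    using assms(2) V_disjoint by blast
  moreover have "(Y' \<union> Y) \<inter> V1 = Y' \<union> (Y \<inter> V1)"
    using assms(2) by blast
  then have "card ((Y' \<union> Y) \<inter> V1) \<le> card Y' + card (Y \<inter> V1)"
    by (simp add: card_Un_le)
  moreover have "card (N \<inter> V) \<le> card ((N' \<union> N) \<inter> V)" for V
    using assms(4) by (intro card_mono) auto
  ultimately show ?thesis
    using assms unfolding good_def by (auto intro: order_trans[OF _ of_nat_mono])
qed

text \<open>The alternative of \<open>good\<close> that forbids positive answers in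
  \<open>V0\<close> is impossible for \<open>i1 = 0\<close>, so adding vertices of \<open>V0\<close>
  to \<open>Y\<close> does no harm.\<close>

lemma good_combine_V0:
  assumes "good j 0 \<delta> Y N" "Y' \<subseteq> V0" "card Y' \<le> b" "finite (N' \<union> N)"
  shows "good (Suc j) 0 \<delta> (Y' \<union> Y) (N' \<union> N)"
proof -
  have "(Y' \<union> Y) \<inter> V1 = Y \<inter> V1"
    using assms(2) V_disjoint by blast
  moreover have "(Y' \<union> Y) \<inter> V0 = Y' \<union> (Y \<inter> V0)"
    using assms(2) by blast
  then have "card ((Y' \<union> Y) \<inter> V0) \<le> card Y' + card (Y \<inter> V0)"
    by (simp add: card_Un_le)
  moreover have "card (N \<inter> V0) \<le> card ((N' \<union> N) \<inter> V0)"
    using assms(4) by (intro card_mono) auto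
  ultimately show ?thesis
    using assms unfolding good_def by auto
qed

definition \<delta>\<^sub>0 :: "nat \<Rightarrow> real \<Rightarrow> real" where
  "\<delta>\<^sub>0 k R = 1 / (2 ^ ((k + 1) * k) * R)"

text \<open>A level with at most \<open>Suc k\<close> vertices per edge multiplies \<open>R\<close>
  by \<open>4 ^ Suc k\<close>. Over k levels this accumulates to 4 to the power 1 + ... + k, which
  is \<open>2 ^ ((k + 1) * k)\<close>.\<close>

lemma \<delta>\<^sub>0_Suc: "\<delta>\<^sub>0 k (4 ^ Suc k * R) = \<delta>\<^sub>0 (Suc k) R"
proof -
  have "(4::real) ^ Suc k = 2 ^ (2 * Suc k)"
    by (simp add: power_mult)
  then have "(2::real) ^ ((k + 1) * k) * 4 ^ Suc k = 2 ^ ((k + 1) * k + 2 * Suc k)"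
    by (simp only: power_add)
  also have "(k + 1) * k + 2 * Suc k = (Suc k + 1) * Suc k"
    by simp
  finally show ?thesis
    unfolding \<delta>\<^sub>0_def by (simp only: mult.assoc[symmetric])
qed

lemma \<delta>\<^sub>0_le: "R > 0 \<Longrightarrow> \<delta>\<^sub>0 (Suc k) R \<le> 1 / (4 * R)"
proof -
  assume R: "R > 0"
  have "2 \<le> (Suc k + 1) * Suc k"
    by simp
  then have "(2::real) ^ 2 \<le> 2 ^ ((Suc k + 1) * Suc k)"
    by (rule power_increasing) simp
  then show ?thesis
    unfolding \<delta>\<^sub>0_def using R by (intro divide_left_mono mult_right_mono) simp_all
qed

lemma tree_exists:
  assumes "finite E" "E \<noteq> {}" "bounded_edges i0 i1 E tr" "spread R E tr" "R > 0"
    and "i0 + i1 = k"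
  shows "\<exists>t. solves i0 i1 (\<delta>\<^sub>0 k R) E tr t"
  using assms
proof (induction k arbitrary: i0 i1 E tr R)
  case 0
  obtain x where x: "x \<in> E"
    using 0 by blast
  \<comment> \<open>An edge without vertices lies in every \<open>X\<close>, so nothing is allowed
    and any tree solves the problem.\<close>
  have "tr x = {}"
    using bounded_edges_card[OF 0(3) x] 0(6) by simp
  then have "\<not> allowed E tr X" for X
    using x by (auto simp: allowed_def)
  then show ?case
    by (simp add: solves_def)
next
  case (Suc k)
  note bE = \<open>bounded_edges i0 i1 E tr\<close> and R = \<open>R > 0\<close>
  \<comment> \<open>For \<open>i1 = 0\<close> the sum condition makes \<open>i0\<close> positive, so
    \<open>i0 - 1\<close> is a true predecessor.\<close>
  define U where "U = (if i1 > 0 then V1 else V0)"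
  define j0 where "j0 = (if i1 > 0 then i0 else i0 - 1)"
  define j1 where "j1 = i1 - 1"
  define M where "M = (if i1 > 0 then card V1 else m)"
  define Q where "Q = (if i1 > 0 then card V1 else q)"
  define \<delta> where "\<delta> = \<delta>\<^sub>0 (Suc k) R"
  define E0 where "E0 = {x \<in> E. tr x \<inter> U = {}}"
  define E1 where "E1 = {x \<in> E. tr x \<inter> U \<noteq> {}}"
  have j: "j0 + j1 = k"
    using Suc.prems(6) by (auto simp: j0_def j1_def)
  have combine: "good i0 i1 \<delta> (Y' \<union> Y) (N' \<union> N)"
    if "good j0 j1 \<delta> Y N" "Y' \<subseteq> U" "card Y' \<le> b" "finite (N' \<union> N)" for Y' N' Y N
  proof (cases "i1 > 0")
    case True
    then show ?thesis
      using good_combine_V1[of i0 "i1 - 1" \<delta> Y N Y' N'] that by (simp add: U_def j0_def j1_def)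
  next
    case False
    then show ?thesis
      using good_combine_V0[of "i0 - 1" \<delta> Y N Y' N'] that Suc.prems(6)
      by (simp add: U_def j0_def j1_def)
  qed
  have cardE: "card E = card E0 + card E1"
  proof -
    have "E = E0 \<union> E1"
      by (auto simp: E0_def E1_def)
    then show ?thesis
      using Suc.prems(1) card_Un_disjoint[of E0 E1] by (auto simp: E0_def E1_def)
  qed
  have posE: "card E > 0"
    using Suc.prems by (simp add: card_gt_0_iff)
  have pow: "(4::real) \<le> 4 ^ Suc k"
    by simp
  \<comment> \<open>Edges missing \<open>U\<close> contain no vertex to be queried, but they already satisfy the size bounds of
    the next level, so they may replace \<open>E\<close> if they are at least a quarter of it.\<close>
  show ?case
  proof (cases "real (card E) \<le> 4 * real (card E0)")
    case True
    have "spread (4 * R) E0 tr"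
      by (rule spread_subset[OF Suc.prems(4,1)]) (use True R in \<open>auto simp: E0_def\<close>)
    then have "spread (4 ^ Suc k * R) E0 tr"
      by (rule spread_mono) (use pow R in \<open>intro mult_right_mono, auto\<close>)
    moreover have "E0 \<noteq> {}"
      using True posE by auto
    moreover have "bounded_edges j0 j1 E0 tr"
      using bE by (auto simp: bounded_edges_def E0_def U_def j0_def j1_def)
    ultimately obtain t where t: "solves j0 j1 \<delta> E0 tr t"
      using Suc.IH[of E0 j0 j1 tr "4 ^ Suc k * R"] Suc.prems(1) R j
      by (auto simp: E0_def \<delta>_def \<delta>\<^sub>0_Suc simp del: power_Suc)
    have "good i0 i1 \<delta> (hits t X) (misses t X)" if "allowed E tr X" for X
      using t allowed_subset[OF that, of E0] combine[of "hits t X" "misses t X" "{}" "{}"]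
      by (auto simp: solves_def E0_def)
    then show ?thesis
      by (auto simp: solves_def \<delta>_def)
  next
    case False
    \<comment> \<open>More than three quarters of the edges meet \<open>U\<close>, whence the factor
      \<open>4 / 3\<close>.\<close>
    then have big: "real (card E) \<le> 4 / 3 * card E1"
      using cardE by linarith
    have "card E1 > 0"
      using big posE by linarith
    then have E1: "finite E1" "E1 \<subseteq> E" "E1 \<noteq> {}"
      by (auto simp: E1_def card_gt_0_iff)
    have bE1: "bounded_edges i0 i1 E1 tr"
      using bE E1(2) by (auto simp: bounded_edges_def)
    have in_V0: "tr x \<subseteq> V0" if "x \<in> E" "i1 = 0" for x
    proof -
      have "tr x \<inter> V1 = {}"
        using bE that finite_V1 by (auto simp: bounded_edges_def)
      then show ?thesis
        using bE that by (auto simp: bounded_edges_def)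
    qed
    have "\<exists>t. solves i0 i1 \<delta> E1 tr t"
    proof (rule level_outcome[OF E1(1,3) bE1 Suc.prems(6) R, where U = U and M = M and Q = Q])
      show "spread (4 / 3 * R) E1 tr"
        by (rule spread_subset[OF Suc.prems(4,1) E1(2) big R])
      show "finite U"
        using finite_V0 finite_V1 by (simp add: U_def)
      show "real b \<le> real M"
        using b_le_m b_le_V1 by (simp add: M_def)
      show "0 < real Q"
        using q_pos card_V1_pos by (simp add: Q_def)
      show "weight {v} = 1 / real Q" if "v \<in> U" for v
        using that weight_singleton_V0 weight_singleton_V1 by (simp add: U_def Q_def split: if_splits)
      show "weight (insert v L) = weight L * (b / real M)"
        if "L \<noteq> {}" "v \<in> U" "v \<notin> L" "x \<in> E1" "insert v L \<subseteq> tr x" for L v x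
      proof (cases "i1 > 0")
        case True
        have "tr x \<subseteq> V0 \<union> V1"
          using bE1 that(4) by (auto simp: bounded_edges_def)
        then show ?thesis
          using True that weight_insert_V1[of v L] by (auto simp: U_def M_def)
      next
        case False
        then show ?thesis
          using that in_V0[of x] E1(2) weight_insert_V0[of v L] by (auto simp: U_def M_def)
      qed
      \<comment> \<open>For \<open>U = V1\<close> all of \<open>V1\<close> serves, since every edge
        of \<open>E1\<close> meets it. For \<open>U = V0\<close> every edge lies in
        \<open>V0\<close> but not in \<open>X\<close>, so \<open>V0 - X\<close> serves, with at most
        \<open>m\<close> elements.\<close>
      show "\<exists>T\<subseteq>U. card T \<le> real M \<and> (\<forall>x\<in>E1. tr x \<inter> T \<noteq> {})" if X: "allowed E1 tr X" for X
      proof (cases "i1 > 0")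
        case True
        then show ?thesis
          by (intro exI[of _ V1]) (auto simp: U_def M_def E1_def)
      next
        case False
        have "tr x \<inter> (V0 - X) \<noteq> {}" if x: "x \<in> E1" for x
        proof -
          have "tr x \<subseteq> V0"
            using in_V0[of x] x E1(2) False by blast
          moreover have "\<not> tr x \<subseteq> X"
            using X x by (simp add: allowed_def)
          ultimately show ?thesis by blast
        qed
        then show ?thesis
          using False X by (intro exI[of _ "V0 - X"]) (auto simp: U_def M_def allowed_def)
      qed
      show "\<exists>t. solves j0 j1 \<delta> P g t"
        if P: "finite P" "P \<noteq> {}" "P \<subseteq> E1" "\<forall>x\<in>P. \<exists>v\<in>U \<inter> tr x. g x = tr x - {v}"
          "spread (4 ^ Suc k * R) P g" for P g
      proof -
        have "bounded_edges j0 j1 P g"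
          unfolding bounded_edges_def
        proof (intro ballI)
          fix x assume x: "x \<in> P"
          then obtain v where v: "v \<in> U" "v \<in> tr x" "g x = tr x - {v}"
            using P(4) by blast
          have xE: "x \<in> E"
            using x P(3) E1(2) by blast
          have *: "tr x \<subseteq> V0 \<union> V1" "card (tr x \<inter> V0) \<le> i0" "card (tr x \<inter> V1) \<le> i1"
            using bE xE by (auto simp: bounded_edges_def)
          have "card (g x \<inter> V) \<le> card (tr x \<inter> V)" if "finite V" for V
            using v(3) that by (intro card_mono) auto
          then have g_le: "card (g x \<inter> V0) \<le> i0" "card (g x \<inter> V1) \<le> i1"
            using * finite_V0 finite_V1 order_trans by blast+
          have "card (g x \<inter> V) = card (tr x \<inter> V) - 1" if "v \<in> V" for V
          proof -
            have "g x \<inter> V = tr x \<inter> V - {v}"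
              using v(3) by blast
            then show ?thesis
              using v(2) that by simp
          qed
          then have "card (g x \<inter> U) = card (tr x \<inter> U) - 1"
            using v(1) by blast
          with g_le show "g x \<subseteq> V0 \<union> V1 \<and> card (g x \<inter> V0) \<le> j0 \<and> card (g x \<inter> V1) \<le> j1"
            using v(3) * by (auto simp: U_def j0_def j1_def split: if_splits)
        qed
        then show ?thesis
          using Suc.IH[OF P(1,2) _ P(5)] R j by (simp add: \<delta>_def \<delta>\<^sub>0_Suc del: power_Suc)
      qed
      show "good i0 i1 \<delta> Y N"
        if Y: "Y \<subseteq> U" "card Y \<le> b" "real Q / (4 * R) \<le> card (N \<inter> U)" for Y N
      proof -
        have "\<delta> * Q \<le> 1 / (4 * R) * Q"
          unfolding \<delta>_def by (intro mult_right_mono \<delta>\<^sub>0_le R) simp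
        then have N: "\<delta> * Q \<le> card (N \<inter> U)"
          using Y(3) by simp
        show ?thesis
        proof (cases "i1 > 0")
          case True
          then have "Y \<inter> V0 = {}" "Y \<inter> V1 = Y" "card Y \<le> i1 * b"
            using Y(1) V_disjoint order_trans[OF Y(2), of "i1 * b"] by (auto simp: U_def)
          then show ?thesis
            using True N by (simp add: good_def U_def Q_def)
        next
          case False
          then have "Y \<inter> V1 = {}" "Y \<inter> V0 = Y" "card Y \<le> i0 * b"
            using Y(1) V_disjoint Suc.prems(6) order_trans[OF Y(2), of "i0 * b"]
            by (auto simp: U_def)
          then show ?thesis
            using False N by (simp add: good_def U_def Q_def)
        qed
      qed
    qed (rule combine)
    then show ?thesis
      using allowed_subset[OF _ E1(2)] by (auto simp: solves_def \<delta>_def)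
  qed
qed

section \<open>Translation from bounded hypergraphs to indexed edges\<close>

lemma codegree_le_max_codegree:
  assumes "L0 \<subseteq> V0" "L1 \<subseteq> V1"
  shows "codegree H L0 L1 \<le> max_codegree V0 V1 H (card L0) (card L1)"
proof -
  let ?A = "{codegree H M0 M1 | M0 M1.
      M0 \<subseteq> V0 \<and> card M0 = card L0 \<and> M1 \<subseteq> V1 \<and> card M1 = card L1}"
  have "?A \<subseteq> (\<lambda>(M0, M1). codegree H M0 M1) ` (Pow V0 \<times> Pow V1)"
    by auto
  then have "finite ?A"
    using finite_V0 finite_V1 by (meson finite_Pow_iff finite_SigmaI finite_imageI finite_subset)
  moreover have "codegree H L0 L1 \<in> ?A"
    using assms by blast
  ultimately show ?thesis
    unfolding max_codegree_def by (intro Max_ge) auto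
qed

lemma
  assumes "bounded_hypergraph V0 V1 r0 r1 H"
  shows bounded_hypergraph_finite: "finite H"
    and bounded_hypergraph_bounded_edges: "bounded_edges r0 r1 H (\<lambda>e. fst e \<union> snd e)"
proof -
  have H: "fst e \<subseteq> V0" "snd e \<subseteq> V1" "card (fst e) \<le> r0" "card (snd e) \<le> r1" if "e \<in> H" for e
    using assms that unfolding bounded_hypergraph_def by (auto simp: case_prod_beta)
  then have "H \<subseteq> Pow V0 \<times> Pow V1"
    by (force simp: subset_eq)
  then show "finite H"
    using finite_V0 finite_V1 by (meson finite_Pow_iff finite_SigmaI finite_subset)
  have "(fst e \<union> snd e) \<inter> V0 = fst e" "(fst e \<union> snd e) \<inter> V1 = snd e" if "e \<in> H" for e
    using H(1,2)[OF that] V_disjoint by blast+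
  then show "bounded_edges r0 r1 H (\<lambda>e. fst e \<union> snd e)"
    unfolding bounded_edges_def using H by (simp add: le_supI1 le_supI2)
qed

text \<open>A set contained in no edge has degree zero, which disposes of every set outside the
  range of the hypothesis. For the others the degree is the codegree of the traces on
  \<open>V0\<close> and \<open>V1\<close>.\<close>

lemma bounded_hypergraph_spread:
  assumes H: "bounded_hypergraph V0 V1 r0 r1 H" and R: "R > 0"
    and bound: "\<And>l0 l1. l0 \<le> r0 \<Longrightarrow> l1 \<le> r1 \<Longrightarrow> (l0, l1) \<noteq> (0, 0) \<Longrightarrow>
           real (max_codegree V0 V1 H l0 l1) \<le>
             R * real b ^ (l0 + l1 - 1) / (real m ^ l0 * real (card V1) ^ l1)
               * real (card H) * (real m / real q) ^ (if l0 > 0 then 1 else 0)"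
  shows "spread R H (\<lambda>e. fst e \<union> snd e)"
  unfolding spread_def
proof (intro allI impI)
  fix L :: "'a set" assume L: "L \<noteq> {}"
  let ?tr = "\<lambda>e :: 'a set \<times> 'a set. fst e \<union> snd e" and ?L0 = "L \<inter> V0" and ?L1 = "L \<inter> V1"
  note bounded = bounded_hypergraph_bounded_edges[OF H]
  show "deg H ?tr L \<le> R * weight L * card H"
  proof (cases "\<exists>e\<in>H. L \<subseteq> ?tr e")
    case False
    then have "deg H ?tr L = 0"
      by (intro deg_eq_0) blast
    then show ?thesis
      using R weight_pos[of L] by simp
  next
    case True
    then obtain e where e: "e \<in> H" "L \<subseteq> ?tr e"
      by blast
    have tr: "?tr e \<subseteq> V0 \<union> V1" "card (?tr e \<inter> V0) \<le> r0" "card (?tr e \<inter> V1) \<le> r1"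
      using bounded e(1) by (auto simp: bounded_edges_def)
    have "card ?L0 \<le> card (?tr e \<inter> V0)" "card ?L1 \<le> card (?tr e \<inter> V1)"
      using e(2) finite_V0 finite_V1 by (auto intro!: card_mono)
    then have small: "card ?L0 \<le> r0" "card ?L1 \<le> r1"
      using tr by linarith+
    have "L = ?L0 \<union> ?L1"
      using e(2) tr(1) by blast
    then have "?L0 \<noteq> {} \<or> ?L1 \<noteq> {}"
      using L by auto
    then have nonzero: "(card ?L0, card ?L1) \<noteq> (0, 0)"
      using finite_V0 finite_V1 by auto
    have sub: "L \<subseteq> fst e' \<union> snd e' \<longleftrightarrow> ?L0 \<subseteq> fst e' \<and> ?L1 \<subseteq> snd e'" if "e' \<in> H" for e'
    proof -
      have "fst e' \<subseteq> V0" "snd e' \<subseteq> V1"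
        using H that by (auto simp: bounded_hypergraph_def case_prod_beta)
      then show ?thesis
        using \<open>L = ?L0 \<union> ?L1\<close> V_disjoint by blast
    qed
    have "deg H ?tr L = codegree H ?L0 ?L1"
      unfolding deg_def codegree_def by (rule arg_cong[of _ _ card]) (use sub in force)
    also have "\<dots> \<le> max_codegree V0 V1 H (card ?L0) (card ?L1)"
      by (intro codegree_le_max_codegree) auto
    finally have "real (deg H ?tr L) \<le> max_codegree V0 V1 H (card ?L0) (card ?L1)"
      by simp
    also note bound[OF small nonzero]
    finally show ?thesis
      by (simp add: weight_def mult_ac split: if_splits)
  qed
qed

text \<open>As the sides are disjoint, removing the encoded set from \<open>V0\<close> leaves
  \<open>I\<close>, and an edge inside the encoded set would be violated.\<close>

lemma independent_allowed:
  assumes "bounded_hypergraph V0 V1 r0 r1 H" "(I, J) \<in> indep_family V0 V1 H m"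
  shows "allowed H (\<lambda>e. fst e \<union> snd e) ((V0 - I) \<union> J)"
proof -
  have IJ: "I \<subseteq> V0" "J \<subseteq> V1" "card I \<le> m" and ind: "independent V0 H (I, J)"
    using assms(2) by (auto simp: indep_family_def)
  have "V0 - ((V0 - I) \<union> J) = I"
    using IJ V_disjoint by blast
  moreover have "\<not> fst e \<union> snd e \<subseteq> (V0 - I) \<union> J" if e: "e \<in> H" for e
  proof
    assume sub: "fst e \<union> snd e \<subseteq> (V0 - I) \<union> J"
    have "fst e \<subseteq> V0" "snd e \<subseteq> V1"
      using assms(1) e by (auto simp: bounded_hypergraph_def case_prod_beta)
    then have "fst e \<subseteq> V0 - I" "snd e \<subseteq> J"
      using sub IJ V_disjoint by blast+
    then show False
      using ind e by (auto simp: independent_def violates_def)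
  qed
  ultimately show ?thesis
    using IJ by (simp add: allowed_def)
qed

end


section \<open>Fingerprints and containers\<close>

theorem theorem2p1:
  fixes r0 r1 :: nat and R :: real
    and V0 V1 :: "'a set" and H :: "('a set \<times> 'a set) set"
    and b m q :: nat
  assumes "r0 \<noteq> 0 \<or> r1 \<noteq> 0"
    and "R > 0"
    and "finite V0" and "finite V1" and "V0 \<inter> V1 = {}"
    and "bounded_hypergraph V0 V1 r0 r1 H"
    and "H \<noteq> {}"
    and "b > 0" and "m > 0" and "q > 0"
    and "b \<le> m" and "b \<le> card V1"
    and "\<And>l0 l1. l0 \<le> r0 \<Longrightarrow> l1 \<le> r1 \<Longrightarrow> (l0, l1) \<noteq> (0, 0) \<Longrightarrow>
           real (max_codegree V0 V1 H l0 l1) \<le>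
             R * real b ^ (l0 + l1 - 1) / (real m ^ l0 * real (card V1) ^ l1)
               * real (card H) * (real m / real q) ^ (if l0 > 0 then 1 else 0)"
  shows "\<exists>S f g.
     S \<subseteq> {(S0, S1). S0 \<subseteq> V0 \<and> card S0 \<le> r0 * b \<and> S1 \<subseteq> V1 \<and> card S1 \<le> r1 * b} \<and>
     f ` S \<subseteq> Pow V0 \<times> Pow V1 \<and>
     g ` indep_family V0 V1 H m \<subseteq> S \<and>
     (let \<delta> = 1 / (2 ^ ((r0 + r1 + 1) * (r0 + r1)) * R) in
       (\<forall>(I, J) \<in> indep_family V0 V1 H m. \<forall>A B. f (g (I, J)) = (A, B) \<longrightarrow>
            A \<subseteq> I \<and> J \<subseteq> B) \<and>
       (\<forall>(A, B) \<in> f ` S. real (card A) \<ge> \<delta> * real q \<or>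
            real (card B) \<le> (1 - \<delta>) * real (card V1)) \<and>
       (\<forall>(I, J) \<in> indep_family V0 V1 H m. \<forall>S0 S1 A B.
            g (I, J) = (S0, S1) \<longrightarrow> f (g (I, J)) = (A, B) \<longrightarrow>
            S0 \<subseteq> V0 - I \<and> S1 \<subseteq> J \<and>
            (card S0 > 0 \<longrightarrow> real (card A) \<ge> \<delta> * real q)))"
proof -
  interpret two_sides V0 V1 b m q
    using assms by unfold_locales auto
  define \<delta> where "\<delta> = \<delta>\<^sub>0 (r0 + r1) R"
  have bH: "bounded_hypergraph V0 V1 r0 r1 H"
    using assms by blast
  have "spread R H (\<lambda>e. fst e \<union> snd e)"
    by (rule bounded_hypergraph_spread) (use assms in blast)+
  then obtain t where t: "solves r0 r1 \<delta> H (\<lambda>e. fst e \<union> snd e) t"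
    using tree_exists[OF bounded_hypergraph_finite[OF bH] \<open>H \<noteq> {}\<close>
        bounded_hypergraph_bounded_edges[OF bH] _ \<open>R > 0\<close> refl] unfolding \<delta>_def by blast
  define g where "g = (\<lambda>(I, J). (hits t ((V0 - I) \<union> J) \<inter> V0, hits t ((V0 - I) \<union> J) \<inter> V1))"
  \<comment> \<open>The tree is run on the fingerprint alone; by \<open>misses_determined\<close> it
    gives the same negative answers as on the encoded pair.\<close>
  define f where "f = (\<lambda>(S0, S1). (misses t (S0 \<union> S1) \<inter> V0, V1 - misses t (S0 \<union> S1)))"
  define F where "F = indep_family V0 V1 H m"
  define Y where "Y = (\<lambda>I J. hits t ((V0 - I) \<union> J))"
  define N where "N = (\<lambda>I J. misses t ((V0 - I) \<union> J))"
  have g: "g (I, J) = (Y I J \<inter> V0, Y I J \<inter> V1)" for I J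
    by (simp add: g_def Y_def)
  have IJ: "I \<subseteq> V0" "J \<subseteq> V1" if "(I, J) \<in> F" for I J
    using that by (auto simp: F_def indep_family_def)
  have YN: "Y I J \<subseteq> (V0 - I) \<union> J" "N I J \<inter> ((V0 - I) \<union> J) = {}" for I J
    unfolding Y_def N_def by (rule hits_subset, rule misses_disjoint)
  have f: "f (g (I, J)) = (N I J \<inter> V0, V1 - N I J)" if "(I, J) \<in> F" for I J
  proof -
    have "Y I J \<inter> V0 \<union> Y I J \<inter> V1 = Y I J"
      using YN(1)[of I J] IJ[OF that] by blast
    moreover have "misses t (Y I J) = N I J"
      unfolding N_def by (rule misses_determined) (use YN(1) in \<open>auto simp: Y_def\<close>)
    ultimately show ?thesis
      by (simp add: f_def g)
  qed
  have good: "good r0 r1 \<delta> (Y I J) (N I J)" if "(I, J) \<in> F" for I J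
    using t independent_allowed[OF bH] that by (simp add: solves_def Y_def N_def F_def)
  have fingerprint: "card (Y I J \<inter> V0) \<le> r0 * b" "card (Y I J \<inter> V1) \<le> r1 * b"
    if "(I, J) \<in> F" for I J
    using good[OF that] by (simp_all add: good_def)
  have nested: "A \<subseteq> I \<and> J \<subseteq> B" if "(I, J) \<in> F" "f (g (I, J)) = (A, B)" for I J A B
    using f[OF that(1)] that(2) YN(2)[of I J] IJ[OF that(1)] by auto
  have container: "\<delta> * q \<le> card (N I J \<inter> V0) \<or> card (V1 - N I J) \<le> (1 - \<delta>) * card V1"
    if "(I, J) \<in> F" for I J
  proof -
    have "card (V1 - N I J) = card V1 - card (N I J \<inter> V1)"
      using finite_V1 by (metis Diff_Int_distrib2 Int_absorb Int_commute card_Diff_subset_Int finite_Int)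
    moreover have "card (N I J \<inter> V1) \<le> card V1"
      using finite_V1 by (intro card_mono) auto
    ultimately have "real (card (V1 - N I J)) = real (card V1) - real (card (N I J \<inter> V1))"
      by (simp add: of_nat_diff)
    then show ?thesis
      using good[OF that] unfolding good_def left_diff_distrib by linarith
  qed
  have placed: "S0 \<subseteq> V0 - I \<and> S1 \<subseteq> J \<and> (card S0 > 0 \<longrightarrow> \<delta> * q \<le> card A)"
    if "(I, J) \<in> F" "g (I, J) = (S0, S1)" "f (g (I, J)) = (A, B)" for I J S0 S1 A B
  proof -
    have eqs: "S0 = Y I J \<inter> V0" "S1 = Y I J \<inter> V1" "A = N I J \<inter> V0"
      using that(2,3) f[OF that(1)] by (simp_all add: g)
    then have "S0 \<subseteq> V0 - I" "S1 \<subseteq> J"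
      using YN(1)[of I J] IJ[OF that(1)] V_disjoint by blast+
    \<comment> \<open>A nonempty \<open>S0\<close> rules out the alternative of \<open>good\<close>
      with \<open>Y \<inter> V0 = {}\<close>.\<close>
    moreover have "card S0 > 0 \<longrightarrow> \<delta> * q \<le> card A"
      using good[OF that(1)] eqs by (auto simp: good_def)
    ultimately show ?thesis by blast
  qed
  \<comment> \<open>The family of fingerprints is the image of \<open>g\<close>, so each container
    to be checked comes from an independent pair.\<close>
  show ?thesis
    unfolding Let_def \<delta>\<^sub>0_def[symmetric] \<delta>_def[symmetric] F_def[symmetric]
  proof (rule exI[of _ "g ` F"], rule exI[of _ f], rule exI[of _ g], intro conjI)
    show "g ` F \<subseteq> {(S0, S1). S0 \<subseteq> V0 \<and> card S0 \<le> r0 * b \<and> S1 \<subseteq> V1 \<and> card S1 \<le> r1 * b}"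
      using fingerprint g by auto
    show "f ` (g ` F) \<subseteq> Pow V0 \<times> Pow V1"
      using f by auto
    show "\<forall>(I, J)\<in>F. \<forall>A B. f (g (I, J)) = (A, B) \<longrightarrow> A \<subseteq> I \<and> J \<subseteq> B"
      using nested by clarify blast
    show "\<forall>(A, B)\<in>f ` (g ` F). \<delta> * real q \<le> real (card A) \<or> real (card B) \<le> (1 - \<delta>) * real (card V1)"
      using container by (clarsimp simp: f) blast
    show "\<forall>(I, J)\<in>F. \<forall>S0 S1 A B. g (I, J) = (S0, S1) \<longrightarrow> f (g (I, J)) = (A, B) \<longrightarrow>
        S0 \<subseteq> V0 - I \<and> S1 \<subseteq> J \<and> (card S0 > 0 \<longrightarrow> \<delta> * real q \<le> real (card A))"
      using placed by clarify blast
  qed simp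
qed

end
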